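(* Let $\mathcal{C}\subseteq\{0,1\}^N$ be a concept class and let $$\mathrm{ADV}(\mathcal{C})=\max_{\Gamma\ge 0}\frac{\|\Gamma\|}{\max_{i\in[N]}\|\Gamma\circ D_i\|}$$ be the nonnegative adversary bound for the exact learning problem corresponding to $\mathcal{C}$. Then there exists a classical learner for $\mathcal{C}$ using $$O\left(\frac{\mathrm{ADV}(\mathcal{C})^2}{\log \mathrm{ADV}(\mathcal{C})}\,\log|\mathcal{C}|\right)$$ membership queries that identifies the target concept with probability $\ge 2/3$.
   Context: $N$ is a positive integer and $[N]=\{1,\dots,N\}$; $O(\cdot)$ hides an absolute constant. In the definition of $\mathrm{ADV}(\mathcal{C})$: $\Gamma$ ranges over $|\mathcal{C}|\times|\mathcal{C}|$ matrices, with rows and columns indexed by $\mathcal{C}$, that have real nonnegative entries and zeros on the diagonal; $D_i$ is the $|\mathcal{C}|\times|\mathcal{C}|$ 0/1-matrix whose $(c,c')$-entry is $1$ if $c_i\ne c'_i$ and $0$ otherwise; $\circ$ is the entrywise product; $\|\cdot\|$ is the operator norm (largest singular value). A classical learner (with membership queries) for $\mathcal{C}$ is a randomized adaptive algorithm that knows $\mathcal{C}$ and has access to an unknown target concept $c\in\mathcal{C}$ only by querying coordinates: a membership query to $i\in[N]$ returns $c_i$. It identifies the target concept if its output equals $c$; the success probability bound is required for every $c\in\mathcal{C}$. *)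

theory Defs
  imports "HOL-Analysis.Analysis" "HOL-Probability.Probability"
begin

text \<open>A concept in \<open>{0,1}\<^sup>N\<close> is a function in \<open>{1..N} \<rightarrow>\<^sub>E UNIV\<close>, with \<open>True\<close> standing for 1.\<close>

type_synonym concept = "nat \<Rightarrow> bool"

definition concepts :: "nat \<Rightarrow> concept set" where
  "concepts N = {1..N} \<rightarrow>\<^sub>E UNIV"

text \<open>
  Operator norm of a real matrix with rows and columns indexed by a finite set \<open>A\<close>; the
  analogue of \<^const>\<open>onorm\<close>. Vectors with \<open>L2_set v A = 0\<close> contribute \<open>0 / 0 = 0\<close>.
\<close>

definition op_norm_on :: "'a set \<Rightarrow> ('a \<Rightarrow> 'a \<Rightarrow> real) \<Rightarrow> real" where
  "op_norm_on A M = (SUP v. L2_set (\<lambda>a. \<Sum>b\<in>A. M a b * v b) A / L2_set v A)"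

definition hadamard :: "('a \<Rightarrow> 'a \<Rightarrow> real) \<Rightarrow> ('a \<Rightarrow> 'a \<Rightarrow> real) \<Rightarrow> 'a \<Rightarrow> 'a \<Rightarrow> real" where
  "hadamard M M' = (\<lambda>a b. M a b * M' a b)"

definition diff_matrix :: "nat \<Rightarrow> concept \<Rightarrow> concept \<Rightarrow> real" where
  "diff_matrix i c c' = (if c i \<noteq> c' i then 1 else 0)"

text \<open>The zero matrix is excluded because its quotient in the adversary bound would be \<open>0 / 0\<close>.\<close>

definition adversary_matrix :: "concept set \<Rightarrow> (concept \<Rightarrow> concept \<Rightarrow> real) \<Rightarrow> bool" where
  "adversary_matrix C \<Gamma> \<longleftrightarrow>
     (\<forall>c\<in>C. \<forall>c'\<in>C. \<Gamma> c c' \<ge> 0) \<and> (\<forall>c\<in>C. \<Gamma> c c = 0) \<and> (\<exists>c\<in>C. \<exists>c'\<in>C. \<Gamma> c c' \<noteq> 0)"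

text \<open>
  For \<open>C \<subseteq> concepts N\<close> with at least two elements the quotients are bounded by \<open>N\<close>, since
  \<open>\<Gamma>\<close> is entrywise at most the sum of its products with the \<open>D\<^sub>i\<close>, and by homogeneity and
  compactness the supremum is a maximum. It is 1 if \<open>C\<close> has two elements and at least \<open>sqrt 2\<close>
  if \<open>C\<close> has more. If \<open>C\<close> has at most one element there is no adversary matrix, and
  \<open>ADV N C\<close> is unspecified.
\<close>

definition ADV :: "nat \<Rightarrow> concept set \<Rightarrow> real" where
  "ADV N C =
     (SUP \<Gamma> \<in> Collect (adversary_matrix C).
        op_norm_on C \<Gamma> / (MAX i\<in>{1..N}. op_norm_on C (hadamard \<Gamma> (diff_matrix i))))"

text \<open>
  Deterministic adaptive query algorithms. In \<open>Query i t0 t1\<close> the algorithm queries coordinate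
  \<open>i\<close> and continues with \<open>t0\<close> on answer 0 and with \<open>t1\<close> on answer 1.
\<close>

datatype (coords: 'i, 'o) query_tree =
  Output 'o
| Query 'i "('i, 'o) query_tree" "('i, 'o) query_tree"

primrec run :: "('i, 'o) query_tree \<Rightarrow> ('i \<Rightarrow> bool) \<Rightarrow> 'o" where
  "run (Output h) c = h"
| "run (Query i t0 t1) c = (if c i then run t1 c else run t0 c)"

primrec num_queries :: "('i, 'o) query_tree \<Rightarrow> ('i \<Rightarrow> bool) \<Rightarrow> nat" where
  "num_queries (Output h) c = 0"
| "num_queries (Query i t0 t1) c = Suc (if c i then num_queries t1 c else num_queries t0 c)"

text \<open>
  A randomized learner draws its random bits in advance and then runs the deterministic
  algorithm they determine. The number of queries is bounded on every run.
\<close>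

definition classical_learner :: "nat \<Rightarrow> concept set \<Rightarrow> nat \<Rightarrow> (nat, concept) query_tree pmf \<Rightarrow> bool" where
  "classical_learner N C q L \<longleftrightarrow>
     (\<forall>t\<in>set_pmf L. coords t \<subseteq> {1..N} \<and> (\<forall>c\<in>C. num_queries t c \<le> q))"

definition identifies_target :: "concept set \<Rightarrow> real \<Rightarrow> (nat, concept) query_tree pmf \<Rightarrow> bool" where
  "identifies_target C p L \<longleftrightarrow> (\<forall>c\<in>C. measure_pmf.prob L {t. run t c = c} \<ge> p)"

end

theory Submission
  imports Defs
begin

text \<open>
  Let \<open>\<mu>\<close> be a distribution on \<open>C\<close> with no very heavy concept. Testing the adversary bound on
  \<open>\<Gamma> a b = sqrt (\<mu> a * \<mu> b)\<close> yields a query both of whose answers have probability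
  \<open>\<Omega>(1 / ADV\<^sup>2)\<close>, which removes \<open>\<Omega>(log ADV / ADV\<^sup>2)\<close> of entropy in expectation. Since the entropy is
  at most \<open>log |C|\<close>, repeating this until some concept is heavy, and cutting off by Markov's
  inequality, gives for each \<open>\<mu>\<close> a query tree of the desired depth with success probability 3/4. A
  minimax argument turns these into one randomized learner.
\<close>

section \<open>Operator norm\<close>

lemma L2_set_abs: "L2_set (\<lambda>a. \<bar>f a\<bar>) A = L2_set f A"
  by (simp add: L2_set_def)

lemma L2_set_pos: "L2_set f A \<noteq> 0 \<Longrightarrow> 0 < L2_set f A"
  by (rule order.not_eq_order_implies_strict) auto

text \<open>A supremum of reals is informative only over a bounded set. The sum of all
  \<open>\<bar>M a b\<bar>\<close> is a crude bound, since each \<open>\<bar>v b\<bar>\<close> is at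
  most the norm of \<open>v\<close>.\<close>

lemma bdd_above_op_norm_on:
  assumes "finite A"
  shows "bdd_above (range (\<lambda>v. L2_set (\<lambda>a. \<Sum>b\<in>A. M a b * v b) A / L2_set v A))"
proof (intro bdd_aboveI2)
  fix v :: "'a \<Rightarrow> real"
  let ?B = "\<Sum>a\<in>A. \<Sum>b\<in>A. \<bar>M a b\<bar>"
  have "L2_set (\<lambda>a. \<Sum>b\<in>A. M a b * v b) A \<le> (\<Sum>a\<in>A. \<bar>\<Sum>b\<in>A. M a b * v b\<bar>)"
    by (rule L2_set_le_sum_abs)
  also have "\<dots> \<le> (\<Sum>a\<in>A. \<Sum>b\<in>A. \<bar>M a b\<bar> * L2_set v A)"
  proof (intro sum_mono order_trans[OF sum_abs])
    fix a b assume "b \<in> A"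
    then have "\<bar>v b\<bar> \<le> L2_set v A"
      using member_le_L2_set[OF assms, of b "\<lambda>b. \<bar>v b\<bar>"] by (simp add: L2_set_abs)
    then show "\<bar>M a b * v b\<bar> \<le> \<bar>M a b\<bar> * L2_set v A"
      by (simp add: abs_mult mult_left_mono)
  qed
  also have "\<dots> = ?B * L2_set v A" by (simp add: sum_distrib_right)
  finally have *: "L2_set (\<lambda>a. \<Sum>b\<in>A. M a b * v b) A \<le> ?B * L2_set v A" .
  have "0 \<le> ?B" by (intro sum_nonneg) auto
  then show "L2_set (\<lambda>a. \<Sum>b\<in>A. M a b * v b) A / L2_set v A \<le> ?B"
    using * by (cases "L2_set v A = 0") (simp_all add: pos_divide_le_eq[OF L2_set_pos])
qed

lemma L2_set_le_op_norm_on: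
  assumes "finite A"
  shows "L2_set (\<lambda>a. \<Sum>b\<in>A. M a b * v b) A \<le> op_norm_on A M * L2_set v A"
proof (cases "L2_set v A = 0")
  case True
  then have "v b = 0" if "b \<in> A" for b using that assms by (simp add: L2_set_eq_0_iff)
  then have "L2_set (\<lambda>a. \<Sum>b\<in>A. M a b * v b) A = 0" by (simp add: L2_set_def)
  then show ?thesis by (simp add: True)
next
  case False
  then have "L2_set v A > 0" by (rule L2_set_pos)
  moreover have "L2_set (\<lambda>a. \<Sum>b\<in>A. M a b * v b) A / L2_set v A \<le> op_norm_on A M"
    unfolding op_norm_on_def by (rule cSUP_upper[OF UNIV_I bdd_above_op_norm_on[OF assms]])
  ultimately show ?thesis by (simp add: divide_le_eq)
qed

lemma op_norm_on_le:
  assumes "0 \<le> B" "\<And>v. L2_set (\<lambda>a. \<Sum>b\<in>A. M a b * v b) A \<le> B * L2_set v A"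
  shows "op_norm_on A M \<le> B"
  unfolding op_norm_on_def
proof (rule cSUP_least)
  fix v :: "'a \<Rightarrow> real"
  show "L2_set (\<lambda>a. \<Sum>b\<in>A. M a b * v b) A / L2_set v A \<le> B"
    using assms by (cases "L2_set v A = 0") (simp_all add: pos_divide_le_eq[OF L2_set_pos])
qed simp

lemma op_norm_on_nonneg:
  assumes "finite A"
  shows "0 \<le> op_norm_on A M"
proof -
  have "L2_set (\<lambda>a. \<Sum>b\<in>A. M a b * 0) A / L2_set (\<lambda>_. 0) A \<le> op_norm_on A M"
    unfolding op_norm_on_def by (rule cSUP_upper[OF UNIV_I bdd_above_op_norm_on[OF assms]])
  then show ?thesis by (simp add: L2_set_def)
qed

lemma L2_set_sum_le: "L2_set (\<lambda>a. \<Sum>i\<in>I. f i a) A \<le> (\<Sum>i\<in>I. L2_set (f i) A)"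
proof (induction I rule: infinite_finite_induct)
  case (insert i I)
  have "L2_set (\<lambda>a. f i a + (\<Sum>i\<in>I. f i a)) A \<le> L2_set (f i) A + L2_set (\<lambda>a. \<Sum>i\<in>I. f i a) A"
    by (rule L2_set_triangle_ineq)
  then show ?case using insert by simp
qed (simp_all add: L2_set_def)

text \<open>Passing from \<open>v\<close> to \<open>\<bar>v\<bar>\<close> keeps the norm of
  \<open>v\<close> and removes cancellation; the triangle inequality then splits the dominating
  sum.\<close>

lemma op_norm_on_le_sum_if_entrywise_le:
  assumes fin: "finite A"
    and le: "\<And>a b. a \<in> A \<Longrightarrow> b \<in> A \<Longrightarrow> \<bar>M a b\<bar> \<le> (\<Sum>i\<in>I. M' i a b)"
  shows "op_norm_on A M \<le> (\<Sum>i\<in>I. op_norm_on A (M' i))"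
proof (rule op_norm_on_le)
  show "0 \<le> (\<Sum>i\<in>I. op_norm_on A (M' i))"
    by (intro sum_nonneg op_norm_on_nonneg fin)
  fix v :: "'a \<Rightarrow> real"
  let ?v = "\<lambda>b. \<bar>v b\<bar>"
  have *: "\<bar>\<Sum>b\<in>A. M a b * v b\<bar> \<le> (\<Sum>i\<in>I. \<Sum>b\<in>A. M' i a b * ?v b)" if "a \<in> A" for a
  proof -
    have "\<bar>\<Sum>b\<in>A. M a b * v b\<bar> \<le> (\<Sum>b\<in>A. (\<Sum>i\<in>I. M' i a b) * ?v b)"
      by (rule order_trans[OF sum_abs]) (auto simp: abs_mult intro!: sum_mono mult_right_mono le that)
    also have "\<dots> = (\<Sum>i\<in>I. \<Sum>b\<in>A. M' i a b * ?v b)"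
      by (subst sum.swap) (simp add: sum_distrib_right)
    finally show ?thesis .
  qed
  have "L2_set (\<lambda>a. \<Sum>b\<in>A. M a b * v b) A = L2_set (\<lambda>a. \<bar>\<Sum>b\<in>A. M a b * v b\<bar>) A"
    by (simp add: L2_set_abs)
  also have "\<dots> \<le> L2_set (\<lambda>a. \<Sum>i\<in>I. \<Sum>b\<in>A. M' i a b * ?v b) A"
    by (rule L2_set_mono) (use * in auto)
  also have "\<dots> \<le> (\<Sum>i\<in>I. L2_set (\<lambda>a. \<Sum>b\<in>A. M' i a b * ?v b) A)"
    by (rule L2_set_sum_le)
  also have "\<dots> \<le> (\<Sum>i\<in>I. op_norm_on A (M' i) * L2_set ?v A)"
    by (intro sum_mono L2_set_le_op_norm_on fin)
  also have "\<dots> = (\<Sum>i\<in>I. op_norm_on A (M' i)) * L2_set v A"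
    by (simp add: L2_set_abs sum_distrib_right)
  finally show "L2_set (\<lambda>a. \<Sum>b\<in>A. M a b * v b) A \<le> (\<Sum>i\<in>I. op_norm_on A (M' i)) * L2_set v A" .
qed

section \<open>The adversary bound and balanced queries\<close>

lemma finite_subset_concepts: "C \<subseteq> concepts N \<Longrightarrow> finite C"
  unfolding concepts_def by (erule finite_subset) (simp add: finite_PiE)

lemma concepts_differ:
  assumes "c \<in> concepts N" "c' \<in> concepts N" "c \<noteq> c'"
  obtains i where "i \<in> {1..N}" "c i \<noteq> c' i"
proof -
  have "\<exists>i\<in>{1..N}. c i \<noteq> c' i"
    using assms PiE_ext[of c "{1..N}" "\<lambda>_. UNIV" c'] unfolding concepts_def by blast
  then show thesis using that by blast
qed

abbreviation max_diff_norm :: "nat \<Rightarrow> concept set \<Rightarrow> (concept \<Rightarrow> concept \<Rightarrow> real) \<Rightarrow> real" where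
  "max_diff_norm N C \<Gamma> \<equiv> MAX i\<in>{1..N}. op_norm_on C (hadamard \<Gamma> (diff_matrix i))"

text \<open>Distinct concepts differ in some coordinate, so each nonzero entry of
  \<open>\<Gamma>\<close> survives in some product with \<open>D\<^sub>i\<close>. The crude factor
  \<open>N\<close> serves to bound the quotients in \<open>ADV\<close> and to exclude a zero
  denominator below a nonzero numerator.\<close>

lemma op_norm_on_le_max_diff_norm:
  assumes C: "C \<subseteq> concepts N" and G: "adversary_matrix C \<Gamma>"
  shows "op_norm_on C \<Gamma> \<le> real N * max_diff_norm N C \<Gamma>"
proof -
  have "op_norm_on C \<Gamma> \<le> (\<Sum>i\<in>{1..N}. op_norm_on C (hadamard \<Gamma> (diff_matrix i)))"
  proof (rule op_norm_on_le_sum_if_entrywise_le[OF finite_subset_concepts[OF C]])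
    fix a b assume ab: "a \<in> C" "b \<in> C"
    have nn: "0 \<le> hadamard \<Gamma> (diff_matrix i) a b" for i
      using ab G by (simp add: hadamard_def diff_matrix_def adversary_matrix_def)
    show "\<bar>\<Gamma> a b\<bar> \<le> (\<Sum>i\<in>{1..N}. hadamard \<Gamma> (diff_matrix i) a b)"
    proof (cases "a = b")
      case True
      then show ?thesis using ab G nn by (simp add: adversary_matrix_def sum_nonneg)
    next
      case False
      then obtain i where i: "i \<in> {1..N}" "a i \<noteq> b i"
        using concepts_differ ab C by blast
      have "\<bar>\<Gamma> a b\<bar> = hadamard \<Gamma> (diff_matrix i) a b"
        using i ab G by (simp add: hadamard_def diff_matrix_def adversary_matrix_def)
      also have "\<dots> \<le> (\<Sum>i\<in>{1..N}. hadamard \<Gamma> (diff_matrix i) a b)"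
        by (rule member_le_sum) (use i nn in auto)
      finally show ?thesis .
    qed
  qed
  also have "\<dots> \<le> of_nat (card {1..N}) * max_diff_norm N C \<Gamma>"
    by (rule sum_bounded_above) auto
  finally show ?thesis by simp
qed

lemma op_norm_on_le_ADV:
  assumes N: "N \<ge> 1" and C: "C \<subseteq> concepts N" and G: "adversary_matrix C \<Gamma>"
  shows "op_norm_on C \<Gamma> \<le> ADV N C * max_diff_norm N C \<Gamma>"
proof -
  let ?q = "\<lambda>\<Gamma>. op_norm_on C \<Gamma> / max_diff_norm N C \<Gamma>"
  have nn: "0 \<le> max_diff_norm N C \<Gamma>" for \<Gamma>
  proof -
    have "0 \<le> op_norm_on C (hadamard \<Gamma> (diff_matrix 1))"
      by (rule op_norm_on_nonneg[OF finite_subset_concepts[OF C]])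
    also have "\<dots> \<le> max_diff_norm N C \<Gamma>"
      by (rule Max_ge) (use N in auto)
    finally show ?thesis .
  qed
  have "bdd_above (?q ` Collect (adversary_matrix C))"
  proof (intro bdd_aboveI2)
    fix \<Gamma> assume "\<Gamma> \<in> Collect (adversary_matrix C)"
    then show "?q \<Gamma> \<le> real N"
      using op_norm_on_le_max_diff_norm[OF C, of \<Gamma>] nn[of \<Gamma>]
      by (cases "max_diff_norm N C \<Gamma> = 0") (auto simp: divide_le_eq)
  qed
  then have "?q \<Gamma> \<le> ADV N C"
    unfolding ADV_def by (intro cSUP_upper) (use G in auto)
  \<comment> \<open>If the denominator is 0, the crude bound forces
    \<open>op_norm_on C \<Gamma>\<close> to be at most 0, so the product form holds there
    too.\<close>
  then show ?thesis
    using op_norm_on_le_max_diff_norm[OF C G] nn[of \<Gamma>]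
    by (cases "max_diff_norm N C \<Gamma> = 0") (auto simp: divide_le_eq split: if_splits)
qed

text \<open>
  The matrix with entries \<open>sqrt (u a * u b)\<close> is rank one up to its diagonal, and its product with
  \<open>D\<^sub>i\<close> consists of two off-diagonal rank-one blocks.
\<close>

definition sqrt_weight_matrix :: "('a \<Rightarrow> real) \<Rightarrow> 'a \<Rightarrow> 'a \<Rightarrow> real" where
  "sqrt_weight_matrix u a b = (if a = b then 0 else sqrt (u a) * sqrt (u b))"

text \<open>With its diagonal filled in, the matrix would have the eigenvector
  \<open>sqrt (u c)\<close> with eigenvalue \<open>sum u C\<close>. Zeroing the diagonal lowers the
  factor at \<open>a\<close> by \<open>u a\<close>, which leaves at least
  \<open>\<delta> * sum u C\<close>.\<close>

lemma op_norm_on_sqrt_weight_matrix_ge: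
  assumes fin: "finite C" and u: "\<And>c. c \<in> C \<Longrightarrow> 0 \<le> u c" and W: "sum u C > 0"
    and \<delta>: "0 \<le> \<delta>" "\<And>c. c \<in> C \<Longrightarrow> u c \<le> (1 - \<delta>) * sum u C"
  shows "\<delta> * sum u C \<le> op_norm_on C (sqrt_weight_matrix u)"
proof -
  let ?v = "\<lambda>c. sqrt (u c)"
  have entry: "(\<Sum>b\<in>C. sqrt_weight_matrix u a b * ?v b) = ?v a * (sum u C - u a)" if "a \<in> C" for a
  proof -
    have "(\<Sum>b\<in>C. sqrt_weight_matrix u a b * ?v b) = (\<Sum>b\<in>C - {a}. ?v a * u b)"
      by (rule sum.mono_neutral_cong_right)
        (use fin u in \<open>auto simp: sqrt_weight_matrix_def\<close>)
    also have "\<dots> = ?v a * sum u (C - {a})" by (rule sum_distrib_left[symmetric])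
    finally show ?thesis using fin that by (simp add: sum_diff1)
  qed
  have "(L2_set ?v C)\<^sup>2 = sum u C"
    unfolding L2_set_def using u by (simp add: sum_nonneg)
  then have "L2_set ?v C \<noteq> 0" using W by auto
  then have "L2_set ?v C > 0" by (rule L2_set_pos)
  have "\<delta> * sum u C * L2_set ?v C = L2_set (\<lambda>a. \<delta> * sum u C * ?v a) C"
    by (rule L2_set_right_distrib) (use \<delta>(1) W in auto)
  also have "\<dots> \<le> L2_set (\<lambda>a. \<Sum>b\<in>C. sqrt_weight_matrix u a b * ?v b) C"
  proof (rule L2_set_mono)
    fix a assume a: "a \<in> C"
    have "\<delta> * sum u C \<le> sum u C - u a" using \<delta>(2)[OF a] by (simp add: algebra_simps)
    then show "\<delta> * sum u C * ?v a \<le> (\<Sum>b\<in>C. sqrt_weight_matrix u a b * ?v b)"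
      unfolding entry[OF a] using u[OF a] by (simp add: mult.commute mult_left_mono)
    show "0 \<le> \<delta> * sum u C * ?v a" using \<delta>(1) W u[OF a] by simp
  qed
  also have "\<dots> \<le> op_norm_on C (sqrt_weight_matrix u) * L2_set ?v C"
    by (rule L2_set_le_op_norm_on[OF fin])
  finally show ?thesis using \<open>L2_set ?v C > 0\<close> by simp
qed

text \<open>Row \<open>a\<close> meets only concepts with the opposite bit at \<open>i\<close>.
  Cauchy-Schwarz on each row, summed over either side, produces the same factor
  \<open>?w0 * ?w1\<close>.\<close>

lemma op_norm_on_sqrt_weight_matrix_diff_le:
  fixes C :: "concept set"
  assumes fin: "finite C" and u: "\<And>c. c \<in> C \<Longrightarrow> 0 \<le> u c"
  shows "op_norm_on C (hadamard (sqrt_weight_matrix u) (diff_matrix i))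
    \<le> sqrt (sum u {c\<in>C. \<not> c i} * sum u {c\<in>C. c i})" (is "_ \<le> sqrt (?w0 * ?w1)")
proof (rule op_norm_on_le)
  have W: "0 \<le> ?w0" "0 \<le> ?w1" using u by (auto intro: sum_nonneg)
  then show "0 \<le> sqrt (?w0 * ?w1)" by simp
  fix v :: "concept \<Rightarrow> real"
  let ?f = "\<lambda>a. \<Sum>b\<in>C. hadamard (sqrt_weight_matrix u) (diff_matrix i) a b * v b"
  let ?V = "\<lambda>x. \<Sum>b | b \<in> C \<and> b i = x. (v b)\<^sup>2"
  let ?m = "\<lambda>x. \<Sum>b | b \<in> C \<and> b i = x. u b"
  have row: "(?f a)\<^sup>2 \<le> u a * (?m (\<not> a i) * ?V (\<not> a i))" if a: "a \<in> C" for a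
  proof -
    have "?f a = (\<Sum>b | b \<in> C \<and> b i = (\<not> a i). sqrt (u a) * (sqrt (u b) * v b))"
      by (rule sum.mono_neutral_cong_right)
        (use fin in \<open>auto simp: sqrt_weight_matrix_def hadamard_def diff_matrix_def\<close>)
    also have "\<dots> = sqrt (u a) * (\<Sum>b | b \<in> C \<and> b i = (\<not> a i). sqrt (u b) * v b)"
      by (simp add: sum_distrib_left)
    finally have "(?f a)\<^sup>2 = u a * (\<Sum>b | b \<in> C \<and> b i = (\<not> a i). sqrt (u b) * v b)\<^sup>2"
      using u[OF a] by (simp add: power_mult_distrib)
    also have "\<dots> \<le> u a * ((\<Sum>b | b \<in> C \<and> b i = (\<not> a i). (sqrt (u b))\<^sup>2) * ?V (\<not> a i))"
      by (intro mult_left_mono Cauchy_Schwarz_ineq_sum u a)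
    also have "(\<Sum>b | b \<in> C \<and> b i = (\<not> a i). (sqrt (u b))\<^sup>2) = ?m (\<not> a i)"
      by (rule sum.cong) (use u in auto)
    finally show ?thesis .
  qed
  have split: "(\<Sum>a\<in>C. g a) = (\<Sum>a\<in>{c\<in>C. c i = False}. g a) + (\<Sum>a\<in>{c\<in>C. c i = True}. g a)"
    for g :: "concept \<Rightarrow> real"
    by (subst sum.union_disjoint[symmetric]) (use fin in \<open>auto intro: sum.cong\<close>)
  have "(\<Sum>a\<in>C. (?f a)\<^sup>2) \<le> (\<Sum>a\<in>C. u a * (?m (\<not> a i) * ?V (\<not> a i)))"
    by (intro sum_mono row)
  also have "\<dots> = ?m False * (?m True * ?V True) + ?m True * (?m False * ?V False)"
    unfolding split sum_distrib_right by (intro arg_cong2[where f="(+)"] sum.cong) auto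
  also have "\<dots> = ?w0 * ?w1 * (\<Sum>a\<in>C. (v a)\<^sup>2)"
    unfolding split by (simp add: algebra_simps)
  finally show "L2_set ?f C \<le> sqrt (?w0 * ?w1) * L2_set v C"
    unfolding L2_set_def by (simp flip: real_sqrt_mult)
qed

text \<open>The coordinate attaining the maximum in the denominator of \<open>ADV\<close> is
  balanced: after normalising by \<open>sum u C\<close>, the two answer probabilities have product
  at least \<open>\<delta>\<^sup>2 / (ADV N C)\<^sup>2\<close>.\<close>

lemma exists_balanced_query:
  assumes N: "N \<ge> 1" and C: "C \<subseteq> concepts N"
    and u: "\<And>c. c \<in> C \<Longrightarrow> 0 \<le> u c" and W: "sum u C > 0"
    and \<delta>: "0 < \<delta>" "\<And>c. c \<in> C \<Longrightarrow> u c \<le> (1 - \<delta>) * sum u C"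
  obtains i where "i \<in> {1..N}"
    "\<delta> * sum u C \<le> ADV N C * sqrt (sum u {c\<in>C. \<not> c i} * sum u {c\<in>C. c i})"
    "0 < ADV N C"
proof -
  let ?\<Gamma> = "sqrt_weight_matrix u"
  have fin: "finite C" by (rule finite_subset_concepts[OF C])
  have pos: "0 < \<delta> * sum u C" using \<delta>(1) W by simp
  have le: "\<delta> * sum u C \<le> op_norm_on C ?\<Gamma>"
    by (rule op_norm_on_sqrt_weight_matrix_ge) (use fin u W \<delta> in auto)
  \<comment> \<open>The positive lower bound on the norm excludes the zero matrix.\<close>
  have "\<exists>c\<in>C. \<exists>c'\<in>C. ?\<Gamma> c c' \<noteq> 0"
  proof (rule ccontr)
    assume "\<not> ?thesis"
    then have "op_norm_on C ?\<Gamma> \<le> 0" by (intro op_norm_on_le) (auto simp: L2_set_def)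
    then show False using pos le by simp
  qed
  then have G: "adversary_matrix C ?\<Gamma>"
    unfolding adversary_matrix_def using u by (auto simp: sqrt_weight_matrix_def)
  have "max_diff_norm N C ?\<Gamma> \<in> (\<lambda>i. op_norm_on C (hadamard ?\<Gamma> (diff_matrix i))) ` {1..N}"
    by (rule Max_in) (use N in auto)
  then obtain i where i: "i \<in> {1..N}"
    "max_diff_norm N C ?\<Gamma> = op_norm_on C (hadamard ?\<Gamma> (diff_matrix i))" by auto
  have A: "\<delta> * sum u C \<le> ADV N C * op_norm_on C (hadamard ?\<Gamma> (diff_matrix i))"
    using le op_norm_on_le_ADV[OF N C G] i(2) by simp
  moreover have "0 \<le> op_norm_on C (hadamard ?\<Gamma> (diff_matrix i))"
    by (rule op_norm_on_nonneg[OF fin])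
  ultimately have Apos: "0 < ADV N C"
    using pos by (meson less_le_trans zero_less_mult_iff not_less)
  have "\<delta> * sum u C \<le> ADV N C * sqrt (sum u {c\<in>C. \<not> c i} * sum u {c\<in>C. c i})"
    by (rule order_trans[OF A])
      (use op_norm_on_sqrt_weight_matrix_diff_le[OF fin u] Apos in simp)
  then show thesis by (rule that[OF i(1) _ Apos])
qed

text \<open>For uniform weights on two concepts and \<open>\<delta> = 1/2\<close>, the left side of
  the balance inequality is 1, while the square root is at most 1 by the arithmetic-geometric mean
  inequality.\<close>

lemma ADV_ge_1:
  assumes N: "N \<ge> 1" and C: "C \<subseteq> concepts N" and card: "card C \<ge> 2"
  shows "ADV N C \<ge> 1"
proof -
  have fin: "finite C" by (rule finite_subset_concepts[OF C])
  obtain T where T: "T \<subseteq> C" "card T = 2" using obtain_subset_with_card_n[OF card] by metis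
  let ?u = "\<lambda>c. if c \<in> T then 1 else (0::real)"
  have W: "sum ?u C = 2" using T fin by (simp add: sum.If_cases Int_absorb1)
  obtain i where i: "1/2 * sum ?u C
      \<le> ADV N C * sqrt (sum ?u {c\<in>C. \<not> c i} * sum ?u {c\<in>C. c i})" and A: "0 < ADV N C"
    by (rule exists_balanced_query[OF N C, of ?u "1/2"]) (use W in auto)
  have split: "sum ?u {c\<in>C. \<not> c i} + sum ?u {c\<in>C. c i} = sum ?u C"
    by (subst sum.union_disjoint[symmetric]) (use fin in \<open>auto intro!: sum.cong\<close>)
  have "sqrt (sum ?u {c\<in>C. \<not> c i} * sum ?u {c\<in>C. c i})
      \<le> (sum ?u {c\<in>C. \<not> c i} + sum ?u {c\<in>C. c i}) / 2"
    by (rule arith_geo_mean_sqrt) (auto intro: sum_nonneg)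
  then have "ADV N C * sqrt (sum ?u {c\<in>C. \<not> c i} * sum ?u {c\<in>C. c i}) \<le> ADV N C * 1"
    using A W split by (intro mult_left_mono) auto
  with i W show ?thesis by simp
qed

section \<open>Entropy gain\<close>

abbreviation xlnx :: "real \<Rightarrow> real" where
  "xlnx x \<equiv> x * ln x"

text \<open>The right side is the total weight times the entropy of the split. The hypothesis makes
  the smaller share at least \<open>1 / y\<close>. A share \<open>1 / r\<close> contributes
  \<open>ln r / r\<close>, which at \<open>r = y\<close> is the source of the logarithmic saving in
  the query bound.\<close>

lemma entropy_gain:
  assumes "0 < x" "0 < z" and y: "y \<ge> 3" "(x + z)\<^sup>2 \<le> x * z * y"
  shows "(x + z) * (ln y / (2 * y)) \<le> xlnx (x + z) - xlnx x - xlnx z"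
  using assms
proof (induction x z rule: linorder_wlog)
  case (sym a b)
  then show ?case by (simp add: algebra_simps)
next
  case (le x z)
  let ?W = "x + z" and ?r = "(x + z) / x"
  have r2: "2 \<le> ?r" using le by (simp add: field_simps)
  have "?W * ?W \<le> (x * y) * ?W"
  proof -
    have "x * z * y \<le> x * ?W * y" using le by (intro mult_mono) auto
    moreover have "?W * ?W \<le> x * z * y" using le by (simp add: power2_eq_square)
    ultimately show ?thesis by (simp add: mult.commute mult.left_commute)
  qed
  then have "?W \<le> x * y" using le by simp
  then have ry: "?r \<le> y" using le by (simp add: field_simps)
  have e: "exp (1::real) \<le> 3" by (rule exp_le)
  have lny: "0 \<le> ln y" using le by simp
  \<comment> \<open>The function \<open>ln r / r\<close> decreases only from \<open>exp 1\<close>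
    on, and \<open>y \<ge> 3\<close> lies beyond that point. For \<open>r\<close> between 2 and
    \<open>exp 1\<close>, the factor 1/2 and \<open>ln 2 \<ge> 1/2\<close> make up for the missing
    monotonicity.\<close>
  have "ln y / (2 * y) \<le> ln ?r / ?r"
  proof (cases "exp 1 \<le> ?r")
    case True
    then have "ln y / y \<le> ln ?r / ?r" by (rule ln_x_over_x_mono) (rule ry)
    moreover have "ln y / (2 * y) \<le> ln y / y" using lny le by (simp add: field_simps)
    ultimately show ?thesis by simp
  next
    case False
    have "ln y / y \<le> ln (exp 1) / exp 1" using e le by (intro ln_x_over_x_mono) auto
    then have "ln y / (2 * y) \<le> (1 / 2) / exp 1" by (simp add: field_simps)
    also have "\<dots> \<le> ln 2 / exp 1"
      using ln2_ge_two_thirds by (intro divide_right_mono) auto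
    also have "\<dots> \<le> ln ?r / ?r" using r2 False by (intro frac_le) auto
    finally show ?thesis .
  qed
  then have "?W * (ln y / (2 * y)) \<le> ?W * (ln ?r / ?r)" using le by (intro mult_left_mono) auto
  also have "\<dots> = x * ln ?r" using le by simp
  also have "\<dots> = x * (ln ?W - ln x)" using le by (simp add: ln_div)
  also have "\<dots> \<le> x * (ln ?W - ln x) + z * (ln ?W - ln z)" using le by simp
  also have "\<dots> = xlnx ?W - xlnx x - xlnx z" by (simp add: algebra_simps)
  finally show ?case .
qed

text \<open>Gibbs' inequality against the uniform distribution, scaled by the total weight: apply
  \<open>ln t \<le> t - 1\<close> to each term, and the resulting linear terms cancel.\<close>

lemma entropy_le_ln_card:
  assumes fin: "finite S" and w: "\<And>c. c \<in> S \<Longrightarrow> 0 < w c" and ne: "S \<noteq> {}"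
  shows "xlnx (sum w S) - (\<Sum>c\<in>S. xlnx (w c)) \<le> sum w S * ln (card S)"
proof -
  let ?W = "sum w S" and ?n = "real (card S)"
  have n: "?n > 0" using fin ne by (simp add: card_gt_0_iff)
  have W: "?W > 0" by (rule sum_pos) (use fin w ne in auto)
  have "w c * (ln ?W - ln (w c) - ln ?n) \<le> ?W / ?n - w c" if c: "c \<in> S" for c
  proof -
    have "ln ?W - ln (w c) - ln ?n = ln (?W / (w c * ?n))"
      using W n w[OF c] by (simp add: ln_div ln_mult)
    also have "\<dots> \<le> ?W / (w c * ?n) - 1"
      by (rule ln_le_minus_one) (use W n w[OF c] in simp)
    finally have "w c * (ln ?W - ln (w c) - ln ?n) \<le> w c * (?W / (w c * ?n) - 1)"
      using w[OF c] by simp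
    also have "\<dots> = ?W / ?n - w c" using w[OF c] n by (simp add: field_simps)
    finally show ?thesis .
  qed
  then have "(\<Sum>c\<in>S. w c * (ln ?W - ln (w c) - ln ?n)) \<le> (\<Sum>c\<in>S. ?W / ?n - w c)"
    by (rule sum_mono)
  also have "\<dots> = 0" using n by (simp add: sum_subtractf)
  also have "(\<Sum>c\<in>S. w c * (ln ?W - ln (w c) - ln ?n))
      = xlnx ?W - (\<Sum>c\<in>S. xlnx (w c)) - ?W * ln ?n"
    by (simp add: right_diff_distrib sum_subtractf sum_distrib_right)
  finally show ?thesis by simp
qed

section \<open>Query trees for weighted classes\<close>

text \<open>Scaled entropy is a potential that each query lowers by at least
  \<open>ln y / (2 * y)\<close> per unit of weight. Weights stay unnormalised so that the two
  branches simply add up. \<open>ADV\<close> refers to the full class throughout, which spares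
  comparing the bounds of subclasses.\<close>

lemma exists_query_tree_average:
  fixes C :: "concept set" and w :: "concept \<Rightarrow> real"
  assumes N: "N \<ge> 1" and C: "C \<subseteq> concepts N"
    and S: "S \<subseteq> C" and w: "\<And>c. c \<in> S \<Longrightarrow> 0 < w c"
    and \<delta>: "0 < \<delta>" and y: "y \<ge> 3" "(ADV N C)\<^sup>2 \<le> \<delta>\<^sup>2 * y"
  shows "\<exists>t. coords t \<subseteq> {1..N} \<and>
     (\<Sum>c\<in>S. w c * real (num_queries t c)) * (ln y / (2 * y))
        \<le> xlnx (sum w S) - (\<Sum>c\<in>S. xlnx (w c)) \<and>
     (1 - \<delta>) * sum w S \<le> sum w {c\<in>S. run t c = c}"
  using S w
proof (induction "card S" arbitrary: S rule: less_induct)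
  case less
  let ?W = "sum w S" and ?g = "ln y / (2 * y)"
  have finC: "finite C" by (rule finite_subset_concepts[OF C])
  have fin: "finite S" using less.prems(1) finC finite_subset by blast
  have le_sum: "w c \<le> ?W" if "c \<in> S" for c
    by (rule member_le_sum[OF that]) (use less.prems(2) fin in \<open>auto intro: less_imp_le\<close>)
  consider (empty) "S = {}" | (heavy) c0 where "c0 \<in> S" "(1 - \<delta>) * ?W \<le> w c0"
    | (split) "S \<noteq> {}" "\<And>c. c \<in> S \<Longrightarrow> w c < (1 - \<delta>) * ?W"
    by (meson not_less)
  then show ?case
  proof cases
    case empty
    then show ?thesis by (intro exI[of _ "Output undefined"]) simp
  next
    case heavy
    \<comment> \<open>A leaf asks nothing, so its cost bound amounts to nonnegativity of the
      entropy.\<close>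
    have "xlnx (w c) \<le> w c * ln ?W" if "c \<in> S" for c
      using less.prems(2)[OF that] le_sum[OF that] by simp
    then have "(\<Sum>c\<in>S. xlnx (w c)) \<le> (\<Sum>c\<in>S. w c * ln ?W)" by (rule sum_mono)
    moreover have "{c \<in> S. run (Output c0) c = c} = {c0}" using heavy by auto
    ultimately show ?thesis
      using heavy(2) by (intro exI[of _ "Output c0"]) (simp add: sum_distrib_right)
  next
    case split
    have W: "?W > 0" by (rule sum_pos) (use fin split(1) less.prems(2) in auto)
    \<comment> \<open>Extension by zero turns weights on \<open>S\<close> into a test of the
      adversary bound of all of \<open>C\<close>.\<close>
    define u where "u c = (if c \<in> S then w c else 0)" for c
    have sumu: "sum u {c\<in>C. P c} = sum w {c\<in>S. P c}" for P
      by (rule sum.mono_neutral_cong_right) (use finC less.prems(1) in \<open>auto simp: u_def\<close>)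
    have uW: "sum u C = ?W" using sumu[of "\<lambda>_. True"] by simp
    \<comment> \<open>Some positive weight lies below this bound, which therefore also covers the
      zero weights outside \<open>S\<close>.\<close>
    have \<delta>1: "0 \<le> (1 - \<delta>) * ?W"
      using split less.prems(2) by (meson all_not_in_conv less_imp_le less_trans)
    obtain i where i: "i \<in> {1..N}"
      and bal: "\<delta> * sum u C \<le> ADV N C * sqrt (sum u {c\<in>C. \<not> c i} * sum u {c\<in>C. c i})"
    proof (rule exists_balanced_query[OF N C, of u \<delta>])
      show "0 \<le> u c" for c using less.prems(2) by (auto simp: u_def intro: less_imp_le)
      show "u c \<le> (1 - \<delta>) * sum u C" for c
        unfolding uW using split(2)[of c] \<delta>1 by (auto simp: u_def)
    qed (use W \<delta> uW in auto)
    define S0 S1 where "S0 = {c\<in>S. \<not> c i}" and "S1 = {c\<in>S. c i}"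
    have S01: "S = S0 \<union> S1" "S0 \<inter> S1 = {}" "finite S0" "finite S1"
      unfolding S0_def S1_def using fin by auto
    have sum01: "(\<Sum>c\<in>S. f c) = (\<Sum>c\<in>S0. f c) + (\<Sum>c\<in>S1. f c)" for f :: "concept \<Rightarrow> real"
      unfolding S01(1) by (rule sum.union_disjoint) (use S01 in auto)
    let ?x = "sum w S0" and ?z = "sum w S1"
    have W01: "?W = ?x + ?z" by (rule sum01)
    have nn: "0 \<le> ?x" "0 \<le> ?z"
      using S01(1) by (auto intro!: sum_nonneg simp: less.prems(2) less_imp_le)
    have bal': "\<delta> * ?W \<le> ADV N C * sqrt (?x * ?z)"
      using bal unfolding uW sumu S0_def S1_def .
    have pos: "0 < \<delta> * ?W" using \<delta> W by simp
    have "?x * ?z \<noteq> 0" using bal' pos by auto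
    then have xz: "0 < ?x" "0 < ?z" using nn by auto
    have "(\<delta> * ?W)\<^sup>2 \<le> (ADV N C * sqrt (?x * ?z))\<^sup>2"
      using bal' pos by (intro power_mono) auto
    also have "\<dots> = (ADV N C)\<^sup>2 * (?x * ?z)" using xz by (simp add: power_mult_distrib)
    also have "\<dots> \<le> \<delta>\<^sup>2 * y * (?x * ?z)" using xz y by (intro mult_right_mono) auto
    finally have "\<delta>\<^sup>2 * ?W\<^sup>2 \<le> \<delta>\<^sup>2 * (?x * ?z * y)"
      by (simp add: power_mult_distrib algebra_simps)
    then have "?W\<^sup>2 \<le> ?x * ?z * y" using \<delta> by simp
    then have gain: "?W * ?g \<le> xlnx ?W - xlnx ?x - xlnx ?z"
      unfolding W01 by (intro entropy_gain xz y)
    have "S0 \<noteq> {}" "S1 \<noteq> {}" using xz by auto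
    then have "S0 \<subset> S" "S1 \<subset> S" using S01 by auto
    then have card: "card S0 < card S" "card S1 < card S" using psubset_card_mono fin by auto
    obtain t0 where t0: "coords t0 \<subseteq> {1..N}"
      "(\<Sum>c\<in>S0. w c * real (num_queries t0 c)) * ?g \<le> xlnx ?x - (\<Sum>c\<in>S0. xlnx (w c))"
      "(1 - \<delta>) * ?x \<le> sum w {c\<in>S0. run t0 c = c}"
      using less.hyps[OF card(1)] less.prems S01 by auto
    obtain t1 where t1: "coords t1 \<subseteq> {1..N}"
      "(\<Sum>c\<in>S1. w c * real (num_queries t1 c)) * ?g \<le> xlnx ?z - (\<Sum>c\<in>S1. xlnx (w c))"
      "(1 - \<delta>) * ?z \<le> sum w {c\<in>S1. run t1 c = c}"
      using less.hyps[OF card(2)] less.prems S01 by auto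
    let ?t = "Query i t0 t1"
    \<comment> \<open>The root query costs \<open>?W\<close> in total. The gain of the split pays
      for it, and the entropies of the two parts pay for the subtrees.\<close>
    have "(\<Sum>c\<in>S. w c * real (num_queries ?t c))
        = (\<Sum>c\<in>S0. w c * real (num_queries t0 c) + w c) + (\<Sum>c\<in>S1. w c * real (num_queries t1 c) + w c)"
      unfolding sum01
      by (intro arg_cong2[where f="(+)"] sum.cong) (auto simp: S0_def S1_def algebra_simps)
    then have "(\<Sum>c\<in>S. w c * real (num_queries ?t c)) * ?g
        = (\<Sum>c\<in>S0. w c * real (num_queries t0 c)) * ?g
          + (\<Sum>c\<in>S1. w c * real (num_queries t1 c)) * ?g + ?W * ?g"
      by (simp add: sum.distrib W01 algebra_simps add_divide_distrib)
    then have cost: "(\<Sum>c\<in>S. w c * real (num_queries ?t c)) * ?g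
        \<le> xlnx ?W - (\<Sum>c\<in>S. xlnx (w c))"
      using t0(2) t1(2) gain unfolding sum01[of "\<lambda>c. xlnx (w c)"] by linarith
    have "{c\<in>S. run ?t c = c} = {c\<in>S0. run t0 c = c} \<union> {c\<in>S1. run t1 c = c}"
      by (auto simp: S0_def S1_def)
    then have "sum w {c\<in>S. run ?t c = c}
        = sum w {c\<in>S0. run t0 c = c} + sum w {c\<in>S1. run t1 c = c}"
      using S01 by (subst sum.union_disjoint[symmetric]) auto
    then have "(1 - \<delta>) * ?W \<le> sum w {c\<in>S. run ?t c = c}"
      using t0(3) t1(3) unfolding W01 by (simp add: algebra_simps)
    with cost i t0(1) t1(1) show ?thesis by (intro exI[of _ ?t]) auto
  qed
qed

section \<open>Truncation at a fixed query budget\<close>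

primrec truncate :: "('i, 'o) query_tree \<Rightarrow> nat \<Rightarrow> ('i, 'o) query_tree" where
  "truncate (Output h) q = Output h"
| "truncate (Query i t0 t1) q =
     (case q of 0 \<Rightarrow> Output undefined | Suc q' \<Rightarrow> Query i (truncate t0 q') (truncate t1 q'))"

lemma coords_truncate: "coords (truncate t q) \<subseteq> coords t"
proof (induction t arbitrary: q)
  case (Query i t0 t1)
  then show ?case by (cases q) (simp_all, blast)
qed simp

lemma num_queries_truncate: "num_queries (truncate t q) c \<le> q"
  by (induction t arbitrary: q) (auto split: nat.split)

lemma run_truncate: "num_queries t c \<le> q \<Longrightarrow> run (truncate t q) c = run t c"
  by (induction t arbitrary: q) (auto split: nat.split if_splits)

text \<open>The failure weight 1/4 is 1/8 for stopping at a heavy concept plus 1/8 for exceeding the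
  budget. The factor 64 is \<open>1 / \<delta>\<^sup>2\<close> for
  \<open>\<delta> = 1/8\<close>.\<close>

lemma exists_query_tree_truncated:
  fixes C :: "concept set" and w :: "concept \<Rightarrow> real"
  assumes N: "N \<ge> 1" and C: "C \<subseteq> concepts N"
    and w: "\<And>c. c \<in> C \<Longrightarrow> 0 \<le> w c"
    and y: "y \<ge> 3" "64 * (ADV N C)\<^sup>2 \<le> y"
    and q: "ln (card C) * (2 * y / ln y) \<le> (real q + 1) / 8"
  shows "\<exists>t. coords t \<subseteq> {1..N} \<and> (\<forall>c. num_queries t c \<le> q) \<and>
     3/4 * sum w C \<le> sum w {c\<in>C. run t c = c}"
proof -
  define S where "S = {c\<in>C. 0 < w c}"
  have finC: "finite C" by (rule finite_subset_concepts[OF C])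
  have S: "S \<subseteq> C" "finite S" "\<And>c. c \<in> S \<Longrightarrow> 0 < w c"
    unfolding S_def using finC by auto
  let ?W = "sum w S" and ?g = "ln y / (2 * y)"
  have sumS: "sum w {c\<in>C. P c} = sum w {c\<in>S. P c}" for P
    by (rule sum.mono_neutral_right) (use finC w in \<open>auto simp: S_def order_less_le\<close>)
  have W: "0 \<le> ?W" by (intro sum_nonneg less_imp_le S(3))
  obtain t where t: "coords t \<subseteq> {1..N}"
    "(\<Sum>c\<in>S. w c * real (num_queries t c)) * ?g \<le> xlnx ?W - (\<Sum>c\<in>S. xlnx (w c))"
    "(1 - 1/8) * ?W \<le> sum w {c\<in>S. run t c = c}"
    using exists_query_tree_average[OF N C S(1), of w "1/8" y] S(3) y
    by (auto simp: power2_eq_square)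
  have g: "?g > 0" using y by simp
  have "xlnx ?W - (\<Sum>c\<in>S. xlnx (w c)) \<le> ?W * ln (card C)"
  proof (cases "S = {}")
    case False
    have "card S \<le> card C" "0 < card S" using S finC False by (auto simp: card_mono card_gt_0_iff)
    then have "?W * ln (card S) \<le> ?W * ln (card C)" using W by (intro mult_left_mono) auto
    with entropy_le_ln_card[of S w, OF S(2,3) False] show ?thesis by linarith
  qed simp
  with t(2) have "(\<Sum>c\<in>S. w c * real (num_queries t c)) * ?g \<le> ?W * ln (card C)" by linarith
  then have "(\<Sum>c\<in>S. w c * real (num_queries t c)) \<le> ?W * ln (card C) / ?g"
    using g by (simp only: pos_le_divide_eq)
  also have "\<dots> = ?W * (ln (card C) * (2 * y / ln y))" by simp
  also have "\<dots> \<le> ?W * ((real q + 1) / 8)" by (intro mult_left_mono q W)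
  finally have cost: "(\<Sum>c\<in>S. w c * real (num_queries t c)) \<le> ?W * ((real q + 1) / 8)" .
  \<comment> \<open>Markov's inequality: more than \<open>q\<close> queries means at least
    \<open>q + 1\<close>, whence \<open>real q + 1\<close> in the hypothesis.\<close>
  let ?L = "{c\<in>S. q < num_queries t c}"
  have "sum w ?L * (real q + 1) = (\<Sum>c\<in>?L. w c * (real q + 1))" by (simp add: sum_distrib_right)
  also have "\<dots> \<le> (\<Sum>c\<in>?L. w c * real (num_queries t c))"
    by (intro sum_mono mult_left_mono) (auto intro: less_imp_le S(3))
  also have "\<dots> \<le> (\<Sum>c\<in>S. w c * real (num_queries t c))"
    by (rule sum_mono2) (use S in \<open>auto simp: less_imp_le\<close>)
  also note cost
  also have "?W * ((real q + 1) / 8) = ?W / 8 * (real q + 1)" by simp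
  finally have "sum w ?L * (real q + 1) \<le> ?W / 8 * (real q + 1)" .
  then have markov: "sum w ?L \<le> ?W / 8" by (rule mult_right_le_imp_le) simp
  let ?t = "truncate t q"
  \<comment> \<open>Truncation can spoil only targets in \<open>?L\<close>.\<close>
  have "sum w {c\<in>S. run t c = c} \<le> sum w ({c\<in>S. run ?t c = c} \<union> ?L)"
    by (rule sum_mono2) (use S run_truncate[of t _ q] in \<open>auto simp: less_imp_le not_less\<close>)
  also have "\<dots> \<le> sum w {c\<in>S. run ?t c = c} + sum w ?L"
    by (subst sum_Un) (use S in \<open>auto intro!: sum_nonneg simp: less_imp_le\<close>)
  finally have "3/4 * ?W \<le> sum w {c\<in>S. run ?t c = c}" using markov t(3) by simp
  then have "3/4 * sum w C \<le> sum w {c\<in>C. run ?t c = c}"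
    using sumS[of "\<lambda>_. True"] sumS[of "\<lambda>c. run ?t c = c"] by simp
  then show ?thesis
    using t(1) coords_truncate[of t q] num_queries_truncate[of t q] by (intro exI[of _ ?t]) auto
qed

section \<open>From weighted success to success on every target\<close>

text \<open>
  An approximate minimax theorem: always answering the weights given by the positive parts of the
  accumulated deficits, the sum of their squares grows by at most \<open>card C\<close> in each round.
\<close>

lemma exists_sequence_small_deficit:
  fixes r :: "'t \<Rightarrow> 'c \<Rightarrow> real"
  assumes fin: "finite C" and r: "\<And>t c. 0 \<le> r t c" "\<And>t c. r t c \<le> 1"
    and \<theta>: "0 \<le> \<theta>" "\<theta> \<le> 1"
    and resp: "\<And>w. (\<And>c. c \<in> C \<Longrightarrow> 0 \<le> w c) \<Longrightarrow> \<exists>t\<in>T. \<theta> * sum w C \<le> (\<Sum>c\<in>C. w c * r t c)"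
  shows "\<exists>s. (\<forall>j<k. s j \<in> T) \<and>
    (\<Sum>c\<in>C. (max 0 (\<Sum>j<k. \<theta> - r (s j) c))\<^sup>2) \<le> real k * real (card C)"
proof (induction k)
  case (Suc k)
  then obtain s where s: "\<forall>j<k. s j \<in> T"
    "(\<Sum>c\<in>C. (max 0 (\<Sum>j<k. \<theta> - r (s j) c))\<^sup>2) \<le> real k * real (card C)" by blast
  define D where "D c = (\<Sum>j<k. \<theta> - r (s j) c)" for c
  obtain t where t: "t \<in> T" "\<theta> * (\<Sum>c\<in>C. max 0 (D c)) \<le> (\<Sum>c\<in>C. max 0 (D c) * r t c)"
    using resp[of "\<lambda>c. max 0 (D c)"] by auto
  have step: "(max 0 (D c + (\<theta> - r t c)))\<^sup>2
      \<le> (max 0 (D c))\<^sup>2 + 2 * (max 0 (D c) * (\<theta> - r t c)) + 1" for c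
  proof -
    have "\<bar>\<theta> - r t c\<bar> \<le> 1" using r[of t c] \<theta> by (simp add: abs_le_iff)
    then have d: "(\<theta> - r t c)\<^sup>2 \<le> 1" by (simp add: abs_square_le_1)
    \<comment> \<open>If the new deficit is negative, the left side is 0; otherwise replacing
      \<open>D c\<close> by its positive part only increases it.\<close>
    have "\<bar>max 0 (D c + (\<theta> - r t c))\<bar> \<le> \<bar>max 0 (D c) + (\<theta> - r t c)\<bar>" by (simp add: max_def)
    then have "(max 0 (D c + (\<theta> - r t c)))\<^sup>2 \<le> (max 0 (D c) + (\<theta> - r t c))\<^sup>2"
      by (simp only: abs_le_square_iff)
    also have "\<dots> = (max 0 (D c))\<^sup>2 + 2 * (max 0 (D c) * (\<theta> - r t c)) + (\<theta> - r t c)\<^sup>2"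
      by (simp add: power2_sum)
    finally show ?thesis using d by linarith
  qed
  have "(\<Sum>c\<in>C. (max 0 (D c + (\<theta> - r t c)))\<^sup>2)
      \<le> (\<Sum>c\<in>C. (max 0 (D c))\<^sup>2 + 2 * (max 0 (D c) * (\<theta> - r t c)) + 1)"
    by (intro sum_mono step)
  also have "\<dots> = (\<Sum>c\<in>C. (max 0 (D c))\<^sup>2)
      + 2 * (\<theta> * (\<Sum>c\<in>C. max 0 (D c)) - (\<Sum>c\<in>C. max 0 (D c) * r t c)) + real (card C)"
    by (simp add: sum.distrib sum_distrib_left sum_subtractf algebra_simps)
  \<comment> \<open>Since \<open>t\<close> answers the weights \<open>max 0 (D c)\<close>, the
    middle term is at most 0.\<close>
  also have "\<dots> \<le> real (Suc k) * real (card C)"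
    using t(2) s(2) by (simp add: D_def algebra_simps)
  finally have "(\<Sum>c\<in>C. (max 0 (\<Sum>j<Suc k. \<theta> - r ((s(k := t)) j) c))\<^sup>2)
      \<le> real (Suc k) * real (card C)"
    by (simp add: D_def)
  moreover have "\<forall>j<Suc k. (s(k := t)) j \<in> T" using s(1) t(1) by (simp add: less_Suc_eq)
  ultimately show ?case by blast
qed simp

text \<open>The distribution plays a uniformly random round of the sequence. Each accumulated
  deficit is at most \<open>sqrt (k * card C)\<close>, so its average over \<open>k\<close> rounds
  is at most \<open>\<epsilon>\<close> once
  \<open>k \<ge> card C / \<epsilon>\<^sup>2\<close>.\<close>

lemma exists_pmf_uniform_success:
  fixes P :: "'t \<Rightarrow> 'c \<Rightarrow> bool"
  assumes fin: "finite C" and \<theta>: "0 \<le> \<theta>" "\<theta> \<le> 1" and \<epsilon>: "0 < \<epsilon>"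
    and resp: "\<And>w. (\<And>c. c \<in> C \<Longrightarrow> 0 \<le> w c) \<Longrightarrow> \<exists>t\<in>T. \<theta> * sum w C \<le> sum w {c\<in>C. P t c}"
  shows "\<exists>L. set_pmf L \<subseteq> T \<and> (\<forall>c\<in>C. measure_pmf.prob L {t. P t c} \<ge> \<theta> - \<epsilon>)"
proof -
  obtain m where m: "real (card C) / \<epsilon>\<^sup>2 \<le> real m" using real_arch_simple by blast
  \<comment> \<open>The successor keeps \<open>k\<close> positive even for empty \<open>C\<close>,
    so that a uniform distribution on the rounds exists.\<close>
  define k where "k = Suc m"
  have k: "real (card C) \<le> real k * \<epsilon>\<^sup>2" "0 < k"
    using m \<epsilon> by (auto simp: k_def divide_le_eq algebra_simps intro: add_increasing)
  let ?r = "\<lambda>t c. if P t c then 1 else (0::real)"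
  have resp': "\<exists>t\<in>T. \<theta> * sum w C \<le> (\<Sum>c\<in>C. w c * ?r t c)" if "\<And>c. c \<in> C \<Longrightarrow> 0 \<le> w c" for w
  proof -
    have "(\<Sum>c\<in>C. w c * ?r t c) = sum w {c\<in>C. P t c}" for t
      by (rule sum.mono_neutral_cong_right) (use fin in auto)
    then show ?thesis using resp[OF that] by simp
  qed
  have r: "0 \<le> ?r t c" "?r t c \<le> 1" for t c by auto
  obtain s where s: "\<forall>j<k. s j \<in> T"
    "(\<Sum>c\<in>C. (max 0 (\<Sum>j<k. \<theta> - ?r (s j) c))\<^sup>2) \<le> real k * real (card C)"
    using exists_sequence_small_deficit[OF fin r \<theta> resp', where k = k] by blast
  define L where "L = map_pmf s (pmf_of_set {..<k})"
  have ne: "{..<k} \<noteq> {}" using k(2) by auto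
  have "set_pmf L \<subseteq> T" unfolding L_def using s(1) ne by (auto simp: set_pmf_of_set)
  moreover have "measure_pmf.prob L {t. P t c} \<ge> \<theta> - \<epsilon>" if c: "c \<in> C" for c
  proof -
    let ?n = "card ({..<k} \<inter> s -` {t. P t c})"
    have D: "(\<Sum>j<k. \<theta> - ?r (s j) c) = real k * \<theta> - real ?n"
      by (simp add: sum_subtractf sum.If_cases vimage_def)
    have "(max 0 (\<Sum>j<k. \<theta> - ?r (s j) c))\<^sup>2
        \<le> (\<Sum>c\<in>C. (max 0 (\<Sum>j<k. \<theta> - ?r (s j) c))\<^sup>2)"
      by (rule member_le_sum[OF c]) (use fin in auto)
    also have "\<dots> \<le> real k * real (card C)" by (rule s(2))
    also have "\<dots> \<le> real k * (real k * \<epsilon>\<^sup>2)" by (intro mult_left_mono k) simp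
    also have "\<dots> = (real k * \<epsilon>)\<^sup>2" by (simp add: power2_eq_square)
    finally have "max 0 (\<Sum>j<k. \<theta> - ?r (s j) c) \<le> real k * \<epsilon>"
      by (rule power2_le_imp_le) (use \<epsilon> in simp)
    then have "real k * (\<theta> - \<epsilon>) \<le> real ?n" unfolding D by (simp add: algebra_simps)
    then have "\<theta> - \<epsilon> \<le> real ?n / real k" using k(2) by (simp add: pos_le_divide_eq mult.commute)
    also have "\<dots> = measure_pmf.prob L {t. P t c}"
      unfolding L_def using ne by (simp add: measure_pmf_of_set)
    finally show ?thesis .
  qed
  ultimately show ?thesis by blast
qed

section \<open>Choice of constants and the final learner\<close>

lemma exists_learner_if_card_ge_2:
  assumes N: "N \<ge> 1" and C: "C \<subseteq> concepts N" and card: "card C \<ge> 2"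
  shows "\<exists>q L. classical_learner N C q L \<and>
    real q \<le> 1024 * ((ADV N C)\<^sup>2 / (if ADV N C = 1 then 1 else log 2 (ADV N C))
      * log 2 (real (card C))) \<and>
    identifies_target C (2/3) L"
proof -
  let ?A = "ADV N C"
  let ?den = "if ?A = 1 then 1 else log 2 ?A"
  have A: "1 \<le> ?A" by (rule ADV_ge_1[OF N C card])
  define y where "y = 64 * ?A\<^sup>2"
  have "1 \<le> ?A\<^sup>2" using A by simp
  then have y: "y \<ge> 64" unfolding y_def by simp
  have den: "0 < ?den" using A by auto
  \<comment> \<open>This trades \<open>log 2 y\<close> for the stated denominator: \<open>y\<close>
    dominates \<open>?A\<close>, and \<open>y \<ge> 64\<close> covers the value 1 used when
    \<open>?A = 1\<close>.\<close>
  have "?den \<le> log 2 y"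
  proof (cases "?A = 1")
    case True
    have "log 2 2 \<le> log 2 y" using y by (subst log_le_cancel_iff) auto
    then show ?thesis using True by simp
  next
    case False
    have "?A * 1 \<le> ?A * (64 * ?A)" using A by (intro mult_left_mono) auto
    then have "?A \<le> y" unfolding y_def by (simp add: power2_eq_square)
    then show ?thesis using A False by simp
  qed
  \<comment> \<open>The 8 cancels the 1/8 in the budget condition. Rounding down keeps
    \<open>q\<close> below the bound, while \<open>q + 1\<close> still reaches \<open>?B\<close>.
    The constant 1024 is \<open>8 * 2 * 64\<close>.\<close>
  let ?B = "8 * (ln (card C) * (2 * y / ln y))"
  define q where "q = nat \<lfloor>?B\<rfloor>"
  have lnC: "0 \<le> ln (real (card C))" using card by simp
  have B: "0 \<le> ?B" using lnC y by simp
  have q: "real q \<le> ?B" "?B \<le> real q + 1" unfolding q_def using B by linarith+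
  have "?B = 16 * y * log 2 (card C) / log 2 y"
    using y by (simp add: log_def)
  also have "\<dots> \<le> 16 * y * log 2 (card C) / ?den"
    by (rule divide_left_mono)
      (use \<open>?den \<le> log 2 y\<close> den y card in auto)
  also have "\<dots> = 1024 * (?A\<^sup>2 / ?den * log 2 (card C))" by (simp add: y_def)
  finally have bound: "real q \<le> 1024 * (?A\<^sup>2 / ?den * log 2 (card C))" using q(1) by linarith
  let ?T = "{t. coords t \<subseteq> {1..N} \<and> (\<forall>c. num_queries t c \<le> q)}"
  \<comment> \<open>The minimax error may use up the slack 1/12 between 3/4 and 2/3.\<close>
  have "\<exists>L. set_pmf L \<subseteq> ?T \<and> (\<forall>c\<in>C. measure_pmf.prob L {t. run t c = c} \<ge> 3/4 - 1/12)"
  proof (rule exists_pmf_uniform_success[OF finite_subset_concepts[OF C]])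
    fix w :: "concept \<Rightarrow> real" assume "\<And>c. c \<in> C \<Longrightarrow> 0 \<le> w c"
    then show "\<exists>t\<in>?T. 3/4 * sum w C \<le> sum w {c\<in>C. run t c = c}"
      using exists_query_tree_truncated[OF N C, of w y q] y q(2) by (auto simp: y_def)
  qed auto
  then obtain L where "set_pmf L \<subseteq> ?T"
    "\<forall>c\<in>C. measure_pmf.prob L {t. run t c = c} \<ge> 3/4 - 1/12" by blast
  then have "classical_learner N C q L" "identifies_target C (2/3) L"
    unfolding classical_learner_def identifies_target_def by auto
  with bound show ?thesis by blast
qed

lemma exists_learner_if_card_le_1:
  assumes "finite C" "card C \<le> 1"
  shows "\<exists>L. classical_learner N C 0 L \<and> identifies_target C (2/3) L"
proof -
  obtain h where h: "\<And>c. c \<in> C \<Longrightarrow> c = h"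
    using assms card_le_Suc0_iff_eq[of C] by (metis One_nat_def)
  have "classical_learner N C 0 (return_pmf (Output h))"
    by (simp add: classical_learner_def)
  moreover have "identifies_target C (2/3) (return_pmf (Output h))"
    unfolding identifies_target_def by (auto dest!: h simp: measure_return_pmf)
  ultimately show ?thesis by blast
qed

text \<open>At \<open>ADV N C = 1\<close> the logarithm vanishes and division by 0 would yield 0,
  demanding a learner without queries; hence the denominator 1 in that case.\<close>

theorem theorem10:
  "\<exists>K::real. K > 0 \<and>
     (\<forall>(N::nat) C. N \<ge> 1 \<longrightarrow> C \<subseteq> concepts N \<longrightarrow>
        (\<exists>q L. classical_learner N C q L \<and>
           real q \<le> K * ((ADV N C)\<^sup>2 / (if ADV N C = 1 then 1 else log 2 (ADV N C)) * log 2 (real (card C))) \<and>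
           identifies_target C (2/3) L))"
proof (rule exI[of _ 1024], intro conjI allI impI)
  fix N :: nat and C assume N: "N \<ge> 1" and C: "C \<subseteq> concepts N"
  show "\<exists>q L. classical_learner N C q L \<and>
      real q \<le> 1024 * ((ADV N C)\<^sup>2 / (if ADV N C = 1 then 1 else log 2 (ADV N C))
        * log 2 (real (card C))) \<and>
      identifies_target C (2/3) L"
  proof (cases "card C \<ge> 2")
    case True
    then show ?thesis by (rule exists_learner_if_card_ge_2[OF N C])
  next
    case False
    then have "card C = 0 \<or> card C = 1" by linarith
    \<comment> \<open>Here \<open>ADV N C\<close> is unspecified, but this factor (for empty
      \<open>C\<close> by the convention \<open>ln 0 = 0\<close>) makes the bound 0 whatever its
      value.\<close>
    then have "log 2 (real (card C)) = 0" by (auto simp: log_def)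
    moreover obtain L where "classical_learner N C 0 L" "identifies_target C (2/3) L"
      using exists_learner_if_card_le_1[OF finite_subset_concepts[OF C]] False by auto
    ultimately show ?thesis by (intro exI[of _ 0] exI[of _ L]) simp
  qed
qed simp

end
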